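(* Let $D$ be an integrally closed domain with quotient field $K$, and let $A\supseteq D$ be a torsion-free $D$-algebra (not necessarily commutative) that is finitely generated as a $D$-module. Assume that $D$ has finite residue rings. Then $A$ is polynomially dense in $A'$ if and only if $\mathrm{Int}_K(A)\subseteq\mathrm{Int}_K(A')$.
   Context: Algebras are associative and unital. Let $B=A\otimes_D K$; $D$, $A$ and $K$ are regarded as subrings of $B$, and $K$ is central in $B$, so polynomials in $K[X]$ can be evaluated at elements of $B$. $D$ has finite residue rings if $D/I$ is finite for every proper nonzero ideal $I\subset D$. An element of $B$ is integral (over $D$) if it is a root of a monic polynomial in $D[X]$; $A'=\{b\in B\mid b\text{ is integral over }D\}$, which contains $A$. For subsets $S\subseteq T\subseteq B$, $\mathrm{Int}_K(S,T)=\{f\in K[X]\mid f(S)\subseteq T\}$ and $\mathrm{Int}_K(T)=\mathrm{Int}_K(T,T)$; $S$ is polynomially dense in $T$ if $\mathrm{Int}_K(S,T)=\mathrm{Int}_K(T)$. *)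

theory Defs
  imports
    "HOL-Computational_Algebra.Computational_Algebra"
    "HOL-Library.Poly_Mapping"
begin

text \<open>
  The domain \<open>D\<close> is the type \<open>'d::idom\<close>, its quotient field \<open>K\<close> is \<open>'d fract\<close> with embedding
  \<^const>\<open>to_fract\<close>, and the algebras \<open>A\<close> and \<open>B\<close> are not necessarily commutative rings of class
  \<^class>\<open>ring_1\<close>. Inclusions between different rings are given by explicit ring homomorphisms.
\<close>

definition is_ring_hom :: "('r::ring_1 \<Rightarrow> 's::ring_1) \<Rightarrow> bool" where
  "is_ring_hom h \<longleftrightarrow>
     h 1 = 1 \<and> (\<forall>x y. h (x + y) = h x + h y) \<and> (\<forall>x y. h (x * y) = h x * h y)"

definition is_algebra_map :: "('d::comm_ring_1 \<Rightarrow> 'a::ring_1) \<Rightarrow> bool" where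
  "is_algebra_map \<iota> \<longleftrightarrow> is_ring_hom \<iota> \<and> (\<forall>d a. \<iota> d * a = a * \<iota> d)"

definition torsion_free_algebra :: "('d::idom \<Rightarrow> 'a::ring_1) \<Rightarrow> bool" where
  "torsion_free_algebra \<iota> \<longleftrightarrow> (\<forall>d a. \<iota> d * a = 0 \<longrightarrow> d = 0 \<or> a = 0)"

definition module_finite_algebra :: "('d::comm_ring_1 \<Rightarrow> 'a::ring_1) \<Rightarrow> bool" where
  "module_finite_algebra \<iota> \<longleftrightarrow>
     (\<exists>G. finite G \<and> module.span (\<lambda>d a. \<iota> d * a) G = UNIV)"

text \<open>
  Value of a polynomial over a commutative ring at an element of an algebra with structure map
  \<open>\<phi>\<close>; \<^const>\<open>poly\<close> is restricted to commutative rings.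
\<close>

definition alg_eval :: "('r::comm_ring_1 \<Rightarrow> 'b::ring_1) \<Rightarrow> 'r poly \<Rightarrow> 'b \<Rightarrow> 'b" where
  "alg_eval \<phi> p b = (\<Sum>i\<le>Polynomial.degree p. \<phi> (coeff p i) * b ^ i)"

definition integral_elt :: "('d::comm_ring_1 \<Rightarrow> 'b::ring_1) \<Rightarrow> 'b \<Rightarrow> bool" where
  "integral_elt \<phi> b \<longleftrightarrow> (\<exists>p. lead_coeff p = 1 \<and> alg_eval \<phi> p b = 0)"

definition integrally_closed_domain :: "'d::idom itself \<Rightarrow> bool" where
  "integrally_closed_domain _ \<longleftrightarrow>
     (\<forall>x::'d fract. integral_elt to_fract x \<longrightarrow> x \<in> range to_fract)"

text \<open>Ideals of \<open>'d\<close> are its submodules as a module over itself.\<close>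

definition finite_residue_rings :: "'d::idom itself \<Rightarrow> bool" where
  "finite_residue_rings _ \<longleftrightarrow>
     (\<forall>I::'d set. module.subspace (*) I \<and> I \<noteq> UNIV \<and> I \<noteq> {0}
        \<longrightarrow> finite ((UNIV :: 'd set) // {(x, y). x - y \<in> I}))"

text \<open>
  The tensor product of the \<open>D\<close>-algebras \<open>A\<close> and \<open>K\<close> with structure maps \<open>\<iota>\<close> and \<open>j\<close> is the free
  abelian group on the set of pairs \<open>(a, k)\<close> modulo the following subgroup.
\<close>

inductive_set tensor_relations ::
    "('d::comm_ring_1 \<Rightarrow> 'a::ring_1) \<Rightarrow> ('d \<Rightarrow> 'k::comm_ring_1) \<Rightarrow> (('a \<times> 'k) \<Rightarrow>\<^sub>0 int) set"
  for \<iota> j where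
  zero: "0 \<in> tensor_relations \<iota> j"
| diff: "x \<in> tensor_relations \<iota> j \<Longrightarrow> y \<in> tensor_relations \<iota> j \<Longrightarrow> x - y \<in> tensor_relations \<iota> j"
| add_left:
    "frag_of (a + a', k) - frag_of (a, k) - frag_of (a', k) \<in> tensor_relations \<iota> j"
| add_right:
    "frag_of (a, k + k') - frag_of (a, k) - frag_of (a, k') \<in> tensor_relations \<iota> j"
| balanced: "frag_of (\<iota> d * a, k) - frag_of (a, j d * k) \<in> tensor_relations \<iota> j"

text \<open>The additive map from the free abelian group to \<open>B\<close> that sends the pair \<open>(a, k)\<close> to
  \<open>\<alpha> a * \<kappa> k\<close>.\<close>

definition tensor_value ::
    "('a::ring_1 \<Rightarrow> 'b::ring_1) \<Rightarrow> ('k::comm_ring_1 \<Rightarrow> 'b) \<Rightarrow> (('a \<times> 'k) \<Rightarrow>\<^sub>0 int) \<Rightarrow> 'b" where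
  "tensor_value \<alpha> \<kappa> x =
     (\<Sum>(a, k)\<in>Poly_Mapping.keys x. of_int (Poly_Mapping.lookup x (a, k)) * (\<alpha> a * \<kappa> k))"

text \<open>
  \<open>B\<close> with \<open>\<alpha>: a \<mapsto> a \<otimes> 1\<close> and \<open>\<kappa>: k \<mapsto> 1 \<otimes> k\<close> is the algebra \<open>A \<otimes>\<^sub>D K\<close>: the last two
  conditions say that \<open>a \<otimes> k \<mapsto> \<alpha> a * \<kappa> k\<close> is a well-defined isomorphism of abelian groups onto
  \<open>B\<close>; the first three amount to its compatibility with the multiplication
  \<open>(a \<otimes> k)(a' \<otimes> k') = aa' \<otimes> kk'\<close> and the unit \<open>1 \<otimes> 1\<close>. (That \<open>\<alpha> \<circ> \<iota> = \<kappa> \<circ> j\<close> follows from the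
  balancing relations.)
\<close>

definition is_tensor_product ::
    "('d::comm_ring_1 \<Rightarrow> 'a::ring_1) \<Rightarrow> ('d \<Rightarrow> 'k::comm_ring_1) \<Rightarrow>
     ('a \<Rightarrow> 'b::ring_1) \<Rightarrow> ('k \<Rightarrow> 'b) \<Rightarrow> bool" where
  "is_tensor_product \<iota> j \<alpha> \<kappa> \<longleftrightarrow>
     is_ring_hom \<alpha> \<and> is_ring_hom \<kappa> \<and> (\<forall>a k. \<alpha> a * \<kappa> k = \<kappa> k * \<alpha> a) \<and>
     surj (tensor_value \<alpha> \<kappa>) \<and>
     {x. tensor_value \<alpha> \<kappa> x = 0} = tensor_relations \<iota> j"

text \<open>\<open>Int\<^sub>K(S, T)\<close>, where \<open>B\<close> is a \<open>K\<close>-algebra via \<open>\<kappa>\<close>.\<close>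

definition Int_poly :: "('k::field \<Rightarrow> 'b::ring_1) \<Rightarrow> 'b set \<Rightarrow> 'b set \<Rightarrow> 'k poly set" where
  "Int_poly \<kappa> S T = {f. alg_eval \<kappa> f ` S \<subseteq> T}"

definition polynomially_dense :: "('k::field \<Rightarrow> 'b::ring_1) \<Rightarrow> 'b set \<Rightarrow> 'b set \<Rightarrow> bool" where
  "polynomially_dense \<kappa> S T \<longleftrightarrow> Int_poly \<kappa> S T = Int_poly \<kappa> T T"

text \<open>\<open>A'\<close>: the elements of \<open>B\<close> integral over \<open>D\<close>.\<close>

definition integral_elements :: "('d::idom fract \<Rightarrow> 'b::ring_1) \<Rightarrow> 'b set" where
  "integral_elements \<kappa> = {b. integral_elt (\<kappa> \<circ> to_fract) b}"

end

theory Submission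
  imports Defs "HOL-Algebra.Algebraic_Closure_Type"
begin

text \<open>
  The substantial direction is that \<open>Int(A) \<subseteq> Int(A')\<close> forces every \<open>f\<close> with \<open>f(A) \<subseteq> A'\<close> to map
  \<open>A'\<close> into \<open>A'\<close>. It suffices to find one monic \<open>h \<in> D[X]\<close> of positive degree with
  \<open>h(f(a)) \<in> A\<close> for all \<open>a \<in> A\<close>: then \<open>h \<circ> f \<in> Int(A)\<close>, so \<open>h(f(b))\<close>, and hence \<open>f(b)\<close>, is
  integral for each \<open>b \<in> A'\<close>.

  Let \<open>A\<close> have \<open>n\<close> generators and let \<open>d \<noteq> 0\<close> be such that \<open>d f\<close> has coefficients in \<open>D\<close>. Since
  \<open>D\<close> is integrally closed, minimal polynomials over \<open>K\<close> of integral elements have coefficients in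
  \<open>D\<close>, so \<open>c = f(a)\<close> is a root of a monic polynomial over \<open>D\<close> of degree at most \<open>n\<close>. With
  \<open>e = d^n\<close>, all powers of \<open>c\<close> therefore lie in \<open>e\<inverse>A\<close>. The quotient of \<open>e\<inverse>A\<close> by \<open>e A\<close> is
  finite, so \<open>c^i - c^j \<in> e A\<close> for some \<open>j < i \<le> N\<close> with \<open>N\<close> independent of \<open>a\<close>, and \<open>h\<close> can be
  taken as \<open>X\<close> times the product of all \<open>X^i - X^j\<close>: the remaining factors only contribute an
  element of \<open>e\<inverse>A\<close>.

  The same pigeonhole argument replaces the Cayley-Hamilton theorem in the proof that elements of
  finitely generated algebras are integral.
\<close>

section \<open>Polynomial evaluation and spans in an algebra with central scalars\<close>

locale algebra_map =
  fixes \<phi> :: "'r::comm_ring_1 \<Rightarrow> 'b::ring_1"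
  assumes algebra_map: "is_algebra_map \<phi>"
begin

lemma hom_1 [simp]: "\<phi> 1 = 1"
  and hom_add: "\<phi> (x + y) = \<phi> x + \<phi> y"
  and hom_mult: "\<phi> (x * y) = \<phi> x * \<phi> y"
  and central: "\<phi> r * b = b * \<phi> r"
  using algebra_map unfolding is_algebra_map_def is_ring_hom_def by blast+

lemma left_commute: "b * (\<phi> r * x) = \<phi> r * (b * x)"
  by (metis central mult.assoc)

sublocale Modules.module "\<lambda>r x. \<phi> r * x"
  by unfold_locales (simp_all add: hom_add hom_mult algebra_simps)

lemma hom_0 [simp]: "\<phi> 0 = 0"
  using hom_add[of 0 0] by simp

lemma alg_eval_altdef:
  assumes "Polynomial.degree p \<le> n"
  shows "alg_eval \<phi> p b = (\<Sum>i\<le>n. \<phi> (Polynomial.coeff p i) * b ^ i)"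
  unfolding alg_eval_def using assms
  by (intro sum.mono_neutral_left) (auto simp: coeff_eq_0)

lemma alg_eval_0 [simp]: "alg_eval \<phi> 0 b = 0"
  by (simp add: alg_eval_def)

lemma alg_eval_add: "alg_eval \<phi> (p + q) b = alg_eval \<phi> p b + alg_eval \<phi> q b"
proof -
  define n where "n = max (Polynomial.degree p) (Polynomial.degree q)"
  have "Polynomial.degree (p + q) \<le> n" "Polynomial.degree p \<le> n" "Polynomial.degree q \<le> n"
    by (auto simp: n_def intro: degree_add_le)
  then show ?thesis
    by (simp add: alg_eval_altdef hom_add distrib_right sum.distrib)
qed

lemma alg_eval_smult: "alg_eval \<phi> (Polynomial.smult c p) b = \<phi> c * alg_eval \<phi> p b"
proof -
  have "Polynomial.degree (Polynomial.smult c p) \<le> Polynomial.degree p"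
    by (rule degree_smult_le)
  then show ?thesis
    by (simp add: alg_eval_altdef[of "Polynomial.smult c p"] alg_eval_def[of \<phi> p] sum_distrib_left)
qed

lemma alg_eval_pCons: "alg_eval \<phi> (pCons c p) b = \<phi> c + b * alg_eval \<phi> p b"
proof -
  have "alg_eval \<phi> (pCons c p) b =
      (\<Sum>i\<le>Suc (Polynomial.degree p). \<phi> (Polynomial.coeff (pCons c p) i) * b ^ i)"
    by (rule alg_eval_altdef) (simp add: degree_pCons_le)
  also have "\<dots> = \<phi> c + (\<Sum>i\<le>Polynomial.degree p. \<phi> (Polynomial.coeff p i) * b ^ Suc i)"
    by (simp del: power_Suc sum.atMost_Suc add: sum.atMost_Suc_shift)
  also have "(\<Sum>i\<le>Polynomial.degree p. \<phi> (Polynomial.coeff p i) * b ^ Suc i) = b * alg_eval \<phi> p b"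
    by (simp add: alg_eval_def sum_distrib_left left_commute)
  finally show ?thesis .
qed

lemma alg_eval_diff: "alg_eval \<phi> (p - q) b = alg_eval \<phi> p b - alg_eval \<phi> q b"
  using alg_eval_add[of "p - q" q b] by simp

lemma alg_eval_mult: "alg_eval \<phi> (p * q) b = alg_eval \<phi> p b * alg_eval \<phi> q b"
  by (induction p)
    (simp_all add: alg_eval_add alg_eval_smult alg_eval_pCons distrib_right mult.assoc)

lemma alg_eval_monom: "alg_eval \<phi> (Polynomial.monom c n) b = \<phi> c * b ^ n"
  by (induction n)
    (simp_all add: monom_0 monom_Suc alg_eval_pCons left_commute)

lemma alg_eval_pcompose: "alg_eval \<phi> (pcompose p q) b = alg_eval \<phi> p (alg_eval \<phi> q b)"
  by (induction p) (simp_all add: pcompose_pCons alg_eval_add alg_eval_mult alg_eval_pCons)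

lemma subspace_mult_left: "subspace S \<Longrightarrow> subspace {x. c * x \<in> S}"
  unfolding subspace_def by (auto simp: distrib_left left_commute)

lemma subspace_mult_right: "subspace S \<Longrightarrow> subspace {x. x * c \<in> S}"
  unfolding subspace_def by (auto simp: distrib_right mult.assoc)

lemma span_times_in_subspace:
  assumes "x \<in> span S" "y \<in> span T" "subspace U" and ST: "\<And>s t. s \<in> S \<Longrightarrow> t \<in> T \<Longrightarrow> s * t \<in> U"
  shows "x * y \<in> U"
proof -
  have "span S \<subseteq> {x. x * t \<in> U}" if "t \<in> T" for t
    using that ST assms(3) by (intro span_minimal subspace_mult_right) auto
  with assms(1) have "span T \<subseteq> {y. x * y \<in> U}"
    using assms(3) by (intro span_minimal subspace_mult_left) auto
  with assms(2) show ?thesis by auto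
qed

lemma alg_eval_in_subspace:
  assumes "subspace S" "\<And>i. Polynomial.coeff p i \<noteq> 0 \<Longrightarrow> b ^ i \<in> S"
  shows "alg_eval \<phi> p b \<in> S"
  unfolding alg_eval_def
proof (rule subspace_sum[OF assms(1)])
  fix i
  show "\<phi> (Polynomial.coeff p i) * b ^ i \<in> S"
    using assms subspace_scale subspace_0 by (cases "Polynomial.coeff p i = 0") auto
qed

text \<open>The bound is put on coefficients, not on the degree, so that \<open>n = 0\<close> is
  covered: there \<open>p\<close> must be \<open>0\<close>.\<close>

lemma span_powers_imp_eval:
  assumes "x \<in> span ((^) b ` {..<n})"
  shows "\<exists>p. x = alg_eval \<phi> p b \<and> (\<forall>i\<ge>n. Polynomial.coeff p i = 0)"
proof -
  let ?T = "{x. \<exists>p. x = alg_eval \<phi> p b \<and> (\<forall>i\<ge>n. Polynomial.coeff p i = 0)}"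
  have "subspace ?T"
  proof (rule subspaceI)
    show "0 \<in> ?T" by (auto intro!: exI[of _ 0])
  next
    fix x y assume "x \<in> ?T" "y \<in> ?T"
    then obtain p q where "x = alg_eval \<phi> p b" "y = alg_eval \<phi> q b"
      "\<forall>i\<ge>n. Polynomial.coeff p i = 0" "\<forall>i\<ge>n. Polynomial.coeff q i = 0" by auto
    then show "x + y \<in> ?T" by (auto intro!: exI[of _ "p + q"] simp: alg_eval_add)
  next
    fix c x assume "x \<in> ?T"
    then obtain p where "x = alg_eval \<phi> p b" "\<forall>i\<ge>n. Polynomial.coeff p i = 0" by auto
    then show "\<phi> c * x \<in> ?T" by (auto intro!: exI[of _ "Polynomial.smult c p"] simp: alg_eval_smult)
  qed
  moreover have "(^) b ` {..<n} \<subseteq> ?T"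
  proof clarify
    fix k assume "k < n"
    then show "\<exists>p. b ^ k = alg_eval \<phi> p b \<and> (\<forall>i\<ge>n. Polynomial.coeff p i = 0)"
      by (intro exI[of _ "Polynomial.monom 1 k"]) (auto simp: alg_eval_monom)
  qed
  ultimately show ?thesis
    using span_minimal assms by blast
qed

lemma monic_eval_0_imp_span_powers:
  assumes "Polynomial.lead_coeff p = 1" "alg_eval \<phi> p b = 0"
  shows "b ^ Polynomial.degree p \<in> span ((^) b ` {..<Polynomial.degree p})"
proof -
  let ?q = "Polynomial.monom 1 (Polynomial.degree p) - p"
  have "alg_eval \<phi> ?q b \<in> span ((^) b ` {..<Polynomial.degree p})"
  proof (rule alg_eval_in_subspace)
    fix i assume "Polynomial.coeff ?q i \<noteq> 0"
    then have "i < Polynomial.degree p"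
      using assms(1) by (cases i "Polynomial.degree p" rule: linorder_cases) (auto simp: coeff_eq_0)
    then show "b ^ i \<in> span ((^) b ` {..<Polynomial.degree p})"
      by (intro span_base) auto
  qed simp
  then show ?thesis
    by (simp add: alg_eval_diff alg_eval_monom assms(2))
qed

lemma span_powers_imp_monic:
  assumes "b ^ n \<in> span ((^) b ` {..<n})"
  shows "\<exists>p. Polynomial.lead_coeff p = 1 \<and> Polynomial.degree p = n \<and> alg_eval \<phi> p b = 0"
proof -
  obtain p where p: "b ^ n = alg_eval \<phi> p b" "\<forall>i\<ge>n. Polynomial.coeff p i = 0"
    using span_powers_imp_eval[OF assms] by blast
  let ?q = "Polynomial.monom 1 n - p"
  have "Polynomial.degree ?q = n"
  proof (rule antisym)
    show "Polynomial.degree ?q \<le> n" by (rule degree_le) (simp add: p)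
    show "n \<le> Polynomial.degree ?q" by (rule le_degree) (simp add: p)
  qed
  then show ?thesis
    using p by (intro exI[of _ ?q]) (simp add: alg_eval_diff alg_eval_monom)
qed

text \<open>This linear form of integrality suits dimension counts and pigeonhole arguments. For
  \<open>n = 0\<close> it reads \<open>1 = 0\<close>, which matches the constant polynomial
  \<open>1\<close>.\<close>

lemma integral_elt_iff: "integral_elt \<phi> b \<longleftrightarrow> (\<exists>n. b ^ n \<in> span ((^) b ` {..<n}))"
  unfolding integral_elt_def
  using monic_eval_0_imp_span_powers span_powers_imp_monic by blast

text \<open>The span is stable under multiplication by \<open>b\<close>: only \<open>b ^ n\<close>
  leaves the generators, and it lies in the span by assumption.\<close>

lemma powers_in_span_powers:
  assumes "b ^ n \<in> span ((^) b ` {..<n})"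
  shows "b ^ i \<in> span ((^) b ` {..<n})"
proof (induction i)
  case 0
  show ?case using assms by (cases "n = 0") (auto intro!: span_base intro: image_eqI[of _ _ 0])
next
  case (Suc i)
  have "span ((^) b ` {..<n}) \<subseteq> {x. b * x \<in> span ((^) b ` {..<n})}"
  proof (intro span_minimal subspace_mult_left subspace_span)
    have "b ^ Suc k \<in> span ((^) b ` {..<n})" if "k < n" for k
      using that assms by (cases "Suc k = n") (auto simp del: power_Suc intro!: span_base)
    then show "(^) b ` {..<n} \<subseteq> {x. b * x \<in> span ((^) b ` {..<n})}" by auto
  qed
  with Suc show ?case by auto
qed

text \<open>Equations move along maps of algebras; this will relate elements of the fraction field
  to their images in its algebraic closure.\<close>

lemma alg_eval_hom:
  assumes "is_algebra_map \<psi>" "\<And>x. \<chi> (\<phi> x) = \<psi> x" "is_ring_hom \<chi>"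
  shows "alg_eval \<psi> p (\<chi> b) = \<chi> (alg_eval \<phi> p b)"
proof -
  interpret \<psi>: algebra_map \<psi> by unfold_locales (rule assms(1))
  have "\<chi> 0 = 0"
    using assms(2)[of 0] by simp
  then show ?thesis
    using assms by (induction p) (auto simp: \<psi>.alg_eval_pCons alg_eval_pCons is_ring_hom_def)
qed

end

section \<open>Finite quotients and the pigeonhole principle\<close>

lemma finite_representatives:
  fixes e :: "'d::idom"
  assumes "finite_residue_rings TYPE('d)" "e \<noteq> 0"
  shows "\<exists>R. finite R \<and> (\<forall>d. \<exists>r\<in>R. e dvd d - r)"
proof (cases "e dvd 1")
  \<comment> \<open>For a unit the ideal is not proper and the hypothesis is silent, but everything
    is then congruent to \<open>0\<close>.\<close>
  case True
  then show ?thesis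
    by (intro exI[of _ "{0}"]) (auto intro: dvd_trans)
next
  case False
  let ?I = "{x. e dvd x}"
  interpret m: Modules.module "(*) :: 'd \<Rightarrow> 'd \<Rightarrow> 'd"
    by unfold_locales (simp_all add: algebra_simps)
  have "1 \<notin> ?I" "e \<in> ?I" using False by simp_all
  then have "?I \<noteq> UNIV" "?I \<noteq> {0}" using assms(2) by (metis UNIV_I, metis singletonD)
  then have I: "m.subspace ?I \<and> ?I \<noteq> UNIV \<and> ?I \<noteq> {0}" by (simp add: m.subspace_def)
  have fin: "finite ((UNIV :: 'd set) // {(x, y). x - y \<in> ?I})"
    by (rule assms(1)[unfolded finite_residue_rings_def, THEN spec, THEN mp, OF I])
  let ?R = "(\<lambda>C. SOME x. x \<in> C) ` ((UNIV :: 'd set) // {(x, y). x - y \<in> ?I})"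
  have "\<exists>r\<in>?R. e dvd d - r" for d
  proof -
    let ?C = "{(x, y). x - y \<in> ?I} `` {d}"
    have "d \<in> ?C" by simp
    then have "(SOME x. x \<in> ?C) \<in> ?C" by (rule someI)
    moreover have "?C \<in> UNIV // {(x, y). x - y \<in> ?I}" by (rule quotientI) simp
    ultimately show ?thesis by blast
  qed
  with fin show ?thesis by blast
qed

context algebra_map
begin

text \<open>This is the finiteness of \<open>M / eM\<close> for a finitely generated module
  \<open>M\<close>. Each new generator multiplies the list by the representatives of its
  coefficient; any choice of coefficient works, so the generators may be dependent.\<close>

lemma finite_representatives_span:
  assumes "finite R" and R: "\<And>d. \<exists>r\<in>R. e dvd d - r" and "finite G"
  shows "\<exists>F. finite F \<and> (\<forall>x\<in>span G. \<exists>y\<in>F. \<exists>z\<in>span G. x - y = \<phi> e * z)"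
  using \<open>finite G\<close>
proof induction
  case empty
  show ?case by (intro exI[of _ "{0}"]) auto
next
  case (insert g G)
  then obtain F where F: "finite F" "\<And>x. x \<in> span G \<Longrightarrow> \<exists>y\<in>F. \<exists>z\<in>span G. x - y = \<phi> e * z"
    by blast
  let ?F = "(\<lambda>(r, y). \<phi> r * g + y) ` (R \<times> F)"
  have "\<exists>y\<in>?F. \<exists>z\<in>span (insert g G). x - y = \<phi> e * z" if x: "x \<in> span (insert g G)" for x
  proof -
    obtain k where k: "x - \<phi> k * g \<in> span G"
      using x by (auto simp: span_insert)
    obtain y z where y: "y \<in> F" "z \<in> span G" "x - \<phi> k * g - y = \<phi> e * z"
      using F(2)[OF k] by blast
    obtain r c where r: "r \<in> R" "k - r = e * c"
      using R[of k] by (auto elim: dvdE)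
    have "\<phi> k = \<phi> r + \<phi> e * \<phi> c"
      using r(2) by (simp add: hom_add[symmetric] hom_mult[symmetric] r(2)[symmetric])
    with y(3) have "x - (\<phi> r * g + y) = \<phi> e * (\<phi> c * g + z)"
      by (simp add: algebra_simps)
    moreover have "\<phi> c * g + z \<in> span (insert g G)"
      using y(2) span_mono[of G "insert g G"] span_scale[OF span_base, of g "insert g G" c]
      by (auto intro: span_add)
    ultimately show ?thesis
      using r(1) y(1) by force
  qed
  moreover have "finite ?F" using assms(1) F(1) by simp
  ultimately show ?case by blast
qed

text \<open>\<open>N\<close> is the number of representatives, so it serves all sequences at once;
  this later makes one polynomial work for all elements.\<close>

lemma span_pigeonhole:
  assumes "finite R" "\<And>d. \<exists>r\<in>R. e dvd d - r" "finite G"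
  shows "\<exists>N. \<forall>x :: nat \<Rightarrow> 'b. (\<forall>i. x i \<in> span G) \<longrightarrow>
           (\<exists>i\<le>N. \<exists>j<i. \<exists>z\<in>span G. x i - x j = \<phi> e * z)"
proof -
  obtain F where F: "finite F" "\<And>x. x \<in> span G \<Longrightarrow> \<exists>y\<in>F. \<exists>z\<in>span G. x - y = \<phi> e * z"
    using finite_representatives_span[OF assms] by blast
  have "\<exists>i\<le>card F. \<exists>j<i. \<exists>z\<in>span G. x i - x j = \<phi> e * z"
    if x: "\<forall>i. x i \<in> span G" for x :: "nat \<Rightarrow> 'b"
  proof -
    have "\<forall>i. \<exists>y z. y \<in> F \<and> z \<in> span G \<and> x i - y = \<phi> e * z"
      using F(2) x by blast
    then obtain y z where yz: "\<And>i. y i \<in> F" "\<And>i. z i \<in> span G" "\<And>i. x i - y i = \<phi> e * z i"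
      by metis
    have "\<not> inj_on y {..card F}"
    proof
      assume "inj_on y {..card F}"
      then have "card {..card F} \<le> card F"
        by (rule card_inj_on_le) (auto simp: yz(1) F(1))
      then show False by simp
    qed
    then obtain i j where ij: "i \<le> card F" "j < i" "y i = y j"
      unfolding inj_on_def by (metis atMost_iff linorder_neqE_nat)
    have "x i - x j = (x i - y i) - (x j - y j)" using ij by simp
    also have "\<dots> = \<phi> e * (z i - z j)" by (simp only: yz(3) right_diff_distrib)
    finally have "x i - x j = \<phi> e * (z i - z j)" .
    moreover have "z i - z j \<in> span G" by (intro span_diff yz)
    ultimately show ?thesis using ij(1,2) by blast
  qed
  then show ?thesis by blast
qed

end

section \<open>Denominators, and spans over \<open>D\<close> compared with spans over
  \<open>K\<close>\<close>

lemma fract_poly_clear_denominators: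
  fixes f :: "'d::idom fract poly"
  shows "\<exists>d g. d \<noteq> 0 \<and> Polynomial.smult (to_fract d) f = fract_poly g"
proof (induction f)
  case 0
  show ?case by (intro exI[of _ 1] exI[of _ 0]) simp
next
  case (pCons a f)
  then obtain d g where dg: "d \<noteq> 0" "Polynomial.smult (to_fract d) f = fract_poly g"
    by blast
  obtain n m where a: "a = Fract n m" "m \<noteq> 0" by (cases a) auto
  have "to_fract (d * m) * a = to_fract (d * n)"
    using a by (simp add: Fract_conv_to_fract)
  moreover have "Polynomial.smult (to_fract (d * m)) f = fract_poly (Polynomial.smult m g)"
    by (simp add: fract_poly_smult dg(2)[symmetric] mult.commute)
  ultimately have "Polynomial.smult (to_fract (d * m)) (pCons a f) =
      fract_poly (pCons (d * n) (Polynomial.smult m g))"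
    by (simp add: map_poly_pCons)
  then show ?case
    using dg(1) a(2) by (intro exI[of _ "d * m"]) auto
qed

lemma is_algebra_map_to_fract: "is_algebra_map to_fract"
  by (simp add: is_algebra_map_def is_ring_hom_def mult.commute)

text \<open>The structure map \<open>\<phi>\<close> is a parameter only because the simplifier would unfold
  \<open>\<kappa> \<circ> to_fract\<close> inside spans.\<close>

locale fract_algebra = K: algebra_map \<kappa> + D: algebra_map \<phi>
  for \<kappa> :: "'d::idom fract \<Rightarrow> 'b::ring_1" and \<phi> :: "'d \<Rightarrow> 'b" +
  assumes \<phi>_eq: "\<phi> d = \<kappa> (to_fract d)"
begin

sublocale V: vector_space "\<lambda>k x. \<kappa> k * x"
  by unfold_locales (rule K.scale_right_distrib K.scale_left_distrib K.scale_scale K.scale_one)+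

lemma cancel: "e \<noteq> 0 \<Longrightarrow> \<phi> e * x = \<phi> e * y \<Longrightarrow> x = y"
  by (simp add: \<phi>_eq)

lemma alg_eval_fract_poly: "alg_eval \<kappa> (fract_poly p) b = alg_eval \<phi> p b"
  by (induction p) (simp_all add: map_poly_pCons K.alg_eval_pCons D.alg_eval_pCons \<phi>_eq[symmetric])

lemma subspace_K_imp_D: "K.subspace S \<Longrightarrow> D.subspace S"
  unfolding K.subspace_def D.subspace_def by (simp add: \<phi>_eq)

lemma span_D_subset_span_K: "D.span S \<subseteq> K.span S"
  by (intro D.span_minimal subspace_K_imp_D K.subspace_span K.span_superset)

text \<open>The elements with a nonzero \<open>D\<close>-multiple in \<open>D.span S\<close> form a
  \<open>K\<close>-subspace containing \<open>S\<close>; conversely, the denominator is inverted in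
  \<open>K\<close>.\<close>

lemma in_span_K_iff: "x \<in> K.span S \<longleftrightarrow> (\<exists>e. e \<noteq> 0 \<and> \<phi> e * x \<in> D.span S)"
proof
  have "K.span S \<subseteq> {x. \<exists>e. e \<noteq> 0 \<and> \<phi> e * x \<in> D.span S}" (is "_ \<subseteq> ?T")
  proof (rule K.span_minimal)
    show "S \<subseteq> ?T" by (auto intro!: exI[of _ 1] D.span_base)
    show "K.subspace ?T"
    proof (rule K.subspaceI)
      show "0 \<in> ?T" by (auto intro!: exI[of _ 1] D.span_zero)
    next
      fix x y assume "x \<in> ?T" "y \<in> ?T"
      then obtain e e' where e: "e \<noteq> 0" "e' \<noteq> 0" "\<phi> e * x \<in> D.span S" "\<phi> e' * y \<in> D.span S"
        by blast
      have "\<phi> (e * e') * (x + y) = \<phi> e' * (\<phi> e * x) + \<phi> e * (\<phi> e' * y)"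
        by (simp add: distrib_left mult.commute)
      also have "\<dots> \<in> D.span S" by (intro D.span_add D.span_scale e)
      finally show "x + y \<in> ?T" using e by (auto intro!: exI[of _ "e * e'"])
    next
      fix c :: "'d fract" and x assume "x \<in> ?T"
      then obtain e where e: "e \<noteq> 0" "\<phi> e * x \<in> D.span S" by blast
      obtain n m where c: "c = Fract n m" "m \<noteq> 0" by (cases c) auto
      have "\<phi> (m * e) * (\<kappa> c * x) = \<phi> n * (\<phi> e * x)"
        using c by (simp add: \<phi>_eq Fract_conv_to_fract mult_ac)
      also have "\<dots> \<in> D.span S" by (intro D.span_scale e)
      finally show "\<kappa> c * x \<in> ?T" using c e by (auto intro!: exI[of _ "m * e"])
    qed
  qed
  then show "x \<in> K.span S \<Longrightarrow> \<exists>e. e \<noteq> 0 \<and> \<phi> e * x \<in> D.span S" by blast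
next
  assume "\<exists>e. e \<noteq> 0 \<and> \<phi> e * x \<in> D.span S"
  then obtain e where e: "e \<noteq> 0" "\<phi> e * x \<in> K.span S"
    using span_D_subset_span_K by blast
  have "\<kappa> (inverse (to_fract e)) * (\<phi> e * x) \<in> K.span S"
    by (intro K.span_scale e)
  then show "x \<in> K.span S" using e(1) by (simp add: \<phi>_eq)
qed

lemma common_denominator:
  assumes "finite F" "F \<subseteq> K.span S"
  shows "\<exists>e. e \<noteq> 0 \<and> (\<forall>x\<in>F. \<phi> e * x \<in> D.span S)"
  using assms
proof (induction F)
  case empty
  show ?case by (auto intro: exI[of _ 1])
next
  case (insert y F)
  then obtain e e' where e: "e \<noteq> 0" "e' \<noteq> 0" "\<forall>x\<in>F. \<phi> e * x \<in> D.span S" "\<phi> e' * y \<in> D.span S"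
    by (auto simp: in_span_K_iff)
  have "\<phi> (e' * e) * x \<in> D.span S" if "x \<in> F" for x
    using D.span_scale[of "\<phi> e * x" S e'] that e by simp
  moreover have "\<phi> (e' * e) * y \<in> D.span S"
    using D.span_scale[of "\<phi> e' * y" S e] e by (simp add: mult.commute)
  ultimately show ?case using e by (intro exI[of _ "e' * e"]) auto
qed

section \<open>Criteria for integrality\<close>

lemma power_in_span_K:
  assumes "finite G" and pow: "\<And>i. b ^ i \<in> K.span G"
  shows "\<exists>m\<le>card G. b ^ m \<in> K.span ((^) b ` {..<m})"
proof (rule ccontr)
  assume neg: "\<not> ?thesis"
  \<comment> \<open>If none of these powers depended on the lower ones, the first
    \<open>card G + 1\<close> powers would be distinct and independent inside the span of
    \<open>G\<close>.\<close>
  have "\<not> K.dependent ((^) b ` {..<n}) \<and> card ((^) b ` {..<n}) = n" if "n \<le> Suc (card G)" for n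
    using that
  proof (induction n)
    case 0
    show ?case by (simp add: K.independent_empty)
  next
    case (Suc n)
    then have *: "b ^ n \<notin> K.span ((^) b ` {..<n})" using neg by auto
    then have "b ^ n \<notin> (^) b ` {..<n}" by (rule contrapos_nn) (rule K.span_base)
    moreover have "\<not> K.dependent (insert (b ^ n) ((^) b ` {..<n}))"
      using Suc * by (intro V.independent_insertI) simp_all
    ultimately show ?case
      using Suc by (simp add: lessThan_Suc)
  qed
  from this[of "Suc (card G)"] have "\<not> K.dependent ((^) b ` {..<Suc (card G)})"
    and c: "card ((^) b ` {..<Suc (card G)}) = Suc (card G)" by simp_all
  then have "card ((^) b ` {..<Suc (card G)}) \<le> card G"
    using V.independent_span_bound[OF assms(1), of "(^) b ` {..<Suc (card G)}"] pow by blast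
  with c show False by simp
qed

text \<open>Let \<open>T\<close> be a \<open>K\<close>-linear projection onto the span of the powers of \<open>b\<close>, which is already spanned by
  those below some \<open>m\<close>, and let \<open>L\<close> be the \<open>D\<close>-span of the latter. Applying \<open>T\<close> shows that the
  powers of \<open>b\<close> lie in \<open>c\<inverse>L\<close> for one nonzero \<open>c\<close>. As \<open>c\<inverse>L / L\<close> is finite, two powers
  with exponents at least \<open>m\<close> are congruent modulo \<open>L\<close>, which yields a monic relation.\<close>

lemma integral_if_powers_bounded:
  assumes frr: "finite_residue_rings TYPE('d)"
    and "finite G" "e \<noteq> 0" and pow: "\<And>i. \<phi> e * b ^ i \<in> D.span G"
  shows "integral_elt \<phi> b"
proof -
  have "b ^ i \<in> K.span G" for i
    using pow assms(3) in_span_K_iff by blast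
  then obtain m where m: "b ^ m \<in> K.span ((^) b ` {..<m})"
    using power_in_span_K[OF assms(2)] by blast
  define S where "S = (^) b ` {..<m}"
  have powS: "b ^ i \<in> K.span S" for i
    using K.powers_in_span_powers[OF m] by (simp add: S_def)
  interpret VP: vector_space_pair "\<lambda>k x. \<kappa> k * x" "\<lambda>k x. \<kappa> k * x" ..
  \<comment> \<open>A left inverse of the identity on \<open>K.span S\<close> is a projection onto
    it.\<close>
  obtain T where T: "range T \<subseteq> K.span S" "\<And>v. v \<in> K.span S \<Longrightarrow> T v = v"
    and lin: "Vector_Spaces.linear (\<lambda>k x. \<kappa> k * x) (\<lambda>k x. \<kappa> k * x) T"
    using VP.linear_exists_left_inverse_on[OF V.linear_ident K.subspace_span[of S]]
    by auto
  interpret T: Vector_Spaces.linear "\<lambda>k x. \<kappa> k * x" "\<lambda>k x. \<kappa> k * x" T by (rule lin)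
  obtain e' where e': "e' \<noteq> 0" "\<forall>x\<in>T ` G. \<phi> e' * x \<in> D.span S"
    using common_denominator[of "T ` G" S] assms(2) T(1) by blast
  have "D.span G \<subseteq> {x. \<phi> e' * T x \<in> D.span S}"
  proof (rule D.span_minimal)
    show "G \<subseteq> {x. \<phi> e' * T x \<in> D.span S}" using e' by auto
    show "D.subspace {x. \<phi> e' * T x \<in> D.span S}"
    proof (rule D.subspaceI)
      fix c :: 'd and x assume x: "x \<in> {x. \<phi> e' * T x \<in> D.span S}"
      have "\<phi> e' * T (\<phi> c * x) = \<phi> c * (\<phi> e' * T x)"
        using T.scale[of "to_fract c" x] by (simp add: \<phi>_eq mult.commute)
      then show "\<phi> c * x \<in> {x. \<phi> e' * T x \<in> D.span S}"
        using x D.span_scale by (metis mem_Collect_eq)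
    qed (auto simp: T.zero T.add distrib_left intro: D.span_zero D.span_add)
  qed
  then have "\<phi> e' * T (\<phi> e * b ^ i) \<in> D.span S" for i
    using pow by blast
  moreover have "T (\<phi> e * b ^ i) = \<phi> e * b ^ i" for i
    unfolding \<phi>_eq by (intro T(2) K.span_scale powS)
  ultimately have bdd: "\<phi> (e' * e) * b ^ i \<in> D.span S" for i
    by simp
  obtain R where "finite R" "\<And>d. \<exists>r\<in>R. e' * e dvd d - r"
    using finite_representatives[OF frr, of "e' * e"] e'(1) assms(3) by auto
  moreover have "finite S" by (simp add: S_def)
  ultimately obtain N where "\<forall>x :: nat \<Rightarrow> 'b. (\<forall>i. x i \<in> D.span S) \<longrightarrow>
      (\<exists>i\<le>N. \<exists>j<i. \<exists>z\<in>D.span S. x i - x j = \<phi> (e' * e) * z)"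
    using D.span_pigeonhole[of R "e' * e" S] by blast
  \<comment> \<open>Shifting the exponents by \<open>m\<close> puts the generators of
    \<open>D.span S\<close> below \<open>m + i\<close>, so that \<open>b ^ (m + i)\<close> becomes
    the leading term.\<close>
  from this[THEN spec, of "\<lambda>i. \<phi> (e' * e) * b ^ (m + i)"] bdd
  obtain i j z where ij: "j < i" "z \<in> D.span S"
    "\<phi> (e' * e) * b ^ (m + i) - \<phi> (e' * e) * b ^ (m + j) = \<phi> (e' * e) * z"
    by blast
  have "b ^ (m + i) - b ^ (m + j) = z"
    by (rule cancel[of "e' * e"]) (use ij e' assms(3) in \<open>simp_all add: right_diff_distrib\<close>)
  then have eq: "b ^ (m + i) = z + b ^ (m + j)" by (simp add: algebra_simps)
  have "S \<subseteq> (^) b ` {..<m + i}" by (auto simp: S_def)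
  then have "z \<in> D.span ((^) b ` {..<m + i})"
    using ij(2) D.span_mono by blast
  moreover have "b ^ (m + j) \<in> D.span ((^) b ` {..<m + i})"
    using ij(1) by (intro D.span_base) auto
  ultimately have "b ^ (m + i) \<in> D.span ((^) b ` {..<m + i})"
    unfolding eq by (rule D.span_add)
  then show ?thesis
    unfolding D.integral_elt_iff by blast
qed

text \<open>Repeated multiplication by \<open>s\<close> keeps \<open>1\<close> inside the span, so
  the powers of \<open>s\<close> are bounded with \<open>e = 1\<close>.\<close>

lemma integral_if_stable_span:
  assumes frr: "finite_residue_rings TYPE('d)"
    and "finite G" "1 \<in> D.span G" "\<And>g. g \<in> G \<Longrightarrow> s * g \<in> D.span G"
  shows "integral_elt \<phi> s"
proof -
  have stable: "D.span G \<subseteq> {x. s * x \<in> D.span G}"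
    using assms(4) by (intro D.span_minimal D.subspace_mult_left) auto
  have "s ^ i \<in> D.span G" for i
    using stable by (induction i) (auto simp: assms(3))
  then show ?thesis
    using integral_if_powers_bounded[OF frr assms(2), of 1 s] by simp
qed

lemma integral_scalar: "integral_elt \<phi> (\<phi> d)"
  unfolding integral_elt_def
proof (intro exI conjI)
  show "alg_eval \<phi> [:- d, 1:] (\<phi> d) = 0"
    by (simp add: D.alg_eval_pCons D.hom_add[symmetric])
qed simp

text \<open>The monomials \<open>x ^ i * y ^ j\<close> with \<open>i < k\<close> and
  \<open>j < l\<close> span a module stable under \<open>x\<close> and \<open>y\<close>. Commutation
  lets \<open>y\<close> pass \<open>x ^ i\<close> in a ring that need not be commutative.\<close>

lemma integral_add_mult:
  assumes frr: "finite_residue_rings TYPE('d)"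
    and "integral_elt \<phi> x" "integral_elt \<phi> y" and comm: "x * y = y * x"
  shows "integral_elt \<phi> (x + y)" "integral_elt \<phi> (x * y)"
proof -
  obtain k l where k: "x ^ k \<in> D.span ((^) x ` {..<k})" and l: "y ^ l \<in> D.span ((^) y ` {..<l})"
    using assms by (auto simp: D.integral_elt_iff)
  define G where "G = (\<lambda>(i, j). x ^ i * y ^ j) ` ({..<k} \<times> {..<l})"
  have all: "x ^ i * y ^ j \<in> D.span G" for i j
    using D.powers_in_span_powers[OF k, of i] D.powers_in_span_powers[OF l, of j]
    by (rule D.span_times_in_subspace) (auto simp: G_def intro!: D.span_base)
  have xG: "x * g \<in> D.span G" if "g \<in> G" for g
    using that all[of "Suc _"] by (auto simp: G_def mult.assoc)
  have "y * (x ^ i * y ^ j) = x ^ i * y ^ Suc j" for i j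
  proof -
    have "y * x ^ i = x ^ i * y" using comm by (simp add: power_commuting_commutes)
    then show ?thesis by (metis mult.assoc power_Suc)
  qed
  then have yG: "y * g \<in> D.span G" if "g \<in> G" for g
    using that all by (auto simp: G_def simp del: power_Suc)
  have ySpan: "D.span G \<subseteq> {z. x * z \<in> D.span G}"
    using xG by (intro D.span_minimal D.subspace_mult_left) auto
  have "finite G" by (simp add: G_def)
  moreover have "1 \<in> D.span G" using all[of 0 0] by simp
  moreover have "(x + y) * g \<in> D.span G" if "g \<in> G" for g
    using that xG yG by (simp add: distrib_right D.span_add)
  moreover have "x * y * g \<in> D.span G" if "g \<in> G" for g
    using yG[OF that] ySpan by (auto simp: mult.assoc)
  ultimately show "integral_elt \<phi> (x + y)" "integral_elt \<phi> (x * y)"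
    using integral_if_stable_span[OF frr] by blast+
qed

end

section \<open>Minimal polynomials over an integrally closed domain\<close>

lemma is_algebra_map_comp_to_fract:
  assumes "is_algebra_map \<kappa>"
  shows "is_algebra_map (\<kappa> \<circ> to_fract)"
proof -
  interpret algebra_map \<kappa> by unfold_locales (rule assms)
  show ?thesis
    unfolding is_algebra_map_def is_ring_hom_def comp_def
    by (intro conjI allI central) (simp_all add: hom_add hom_mult)
qed


text \<open>In an algebraic closure of the fraction field, the coefficients of the factor are polynomials
  in its roots, which are roots of \<open>q\<close>.\<close>

lemma monic_factor_in_fract_poly:
  fixes q :: "'d::idom poly"
  assumes ic: "integrally_closed_domain TYPE('d)" and frr: "finite_residue_rings TYPE('d)"
    and q: "Polynomial.lead_coeff q = 1" and P: "Polynomial.lead_coeff P = 1" "P dvd fract_poly q"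
  shows "\<exists>p. P = fract_poly p"
proof -
  define \<theta> :: "'d \<Rightarrow> 'd fract alg_closure" where "\<theta> = to_ac \<circ> to_fract"
  have ac: "is_algebra_map (to_ac :: 'd fract \<Rightarrow> _)"
    by (simp add: is_algebra_map_def is_ring_hom_def mult.commute)
  interpret fract_algebra to_ac \<theta>
    by unfold_locales (use ac in \<open>simp_all add: \<theta>_def is_algebra_map_comp_to_fract\<close>)
  have eval_ac: "alg_eval to_ac p x = poly (map_poly to_ac p) x" for p :: "'d fract poly" and x
    by (induction p) (simp_all add: K.alg_eval_pCons map_poly_pCons)
  define P' where "P' = map_poly to_ac P"
  have lead: "Polynomial.lead_coeff P' = 1"
    using P(1) by (simp add: P'_def coeff_map_poly degree_map_poly)
  then have "P' \<noteq> 0" by auto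
  from alg_closed_imp_factorization[OF this] obtain A
    where A: "P' = (\<Prod>z\<in>#A. [:- z, 1:])"
    unfolding lead by auto
  have int: "integral_elt \<theta> z" if "z \<in># A" for z
  proof -
    have "poly P' z = 0"
      using that by (auto simp: A poly_prod_mset image_iff)
    then have "alg_eval to_ac P z = 0" by (simp add: eval_ac P'_def)
    then have "alg_eval to_ac (fract_poly q) z = 0"
      using P(2) by (auto simp: K.alg_eval_mult elim!: dvdE)
    then show ?thesis
      using q unfolding integral_elt_def by (auto simp: alg_eval_fract_poly)
  qed
  \<comment> \<open>Induction over submultisets of \<open>A\<close> keeps every new root integral;
    multiplying by \<open>X - z\<close> only forms sums and products of integral elements.\<close>
  have "integral_elt \<theta> (Polynomial.coeff (\<Prod>z\<in>#B. [:- z, 1:]) i)" if "B \<subseteq># A" for B i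
    using that
  proof (induction B arbitrary: i)
    case empty
    show ?case
      using integral_scalar[of 0] integral_scalar[of 1] by (cases i) simp_all
  next
    case (add z B)
    let ?p = "\<Prod>z\<in>#B. [:- z, 1:]"
    have z: "integral_elt \<theta> z"
      using add.prems by (intro int) (auto dest: mset_subset_eq_insertD)
    have IH: "integral_elt \<theta> (Polynomial.coeff ?p j)" for j
      using add by (auto dest: mset_subset_eq_insertD subset_mset.less_imp_le)
    \<comment> \<open>The sign is written as the scalar \<open>\<theta> (- 1)\<close>, whose
      integrality is known.\<close>
    have "integral_elt \<theta> (\<theta> (- 1) * z * Polynomial.coeff ?p i)"
      by (intro integral_add_mult(2) frr z IH integral_scalar) (simp_all add: mult_ac)
    moreover have "integral_elt \<theta> (Polynomial.coeff (pCons 0 ?p) i)"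
      using IH integral_scalar[of 0] by (cases i) simp_all
    moreover have "Polynomial.coeff (\<Prod>z\<in>#add_mset z B. [:- z, 1:]) i =
        \<theta> (- 1) * z * Polynomial.coeff ?p i + Polynomial.coeff (pCons 0 ?p) i"
      by (simp add: \<theta>_def)
    ultimately show ?case
      by (simp only: integral_add_mult(1)[OF frr _ _ mult.commute])
  qed
  then have "integral_elt \<theta> (to_ac (Polynomial.coeff P i))" for i
    using subset_mset.order_refl[of A] by (metis A P'_def coeff_map_poly to_ac_0)
  \<comment> \<open>Since \<open>to_ac\<close> is injective, an equation for the image of a
    coefficient already holds in the fraction field.\<close>
  moreover have "alg_eval \<theta> p (to_ac x) = to_ac (alg_eval to_fract p x)" for p and x :: "'d fract"
  proof -
    interpret F: algebra_map "to_fract :: 'd \<Rightarrow> _"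
      by unfold_locales (rule is_algebra_map_to_fract)
    show ?thesis
      by (rule F.alg_eval_hom[OF D.algebra_map]) (simp_all add: \<theta>_def is_ring_hom_def)
  qed
  ultimately have "integral_elt to_fract (Polynomial.coeff P i)" for i
    by (simp add: integral_elt_def)
  then have "\<forall>i. \<exists>d. Polynomial.coeff P i = to_fract d"
    using ic unfolding integrally_closed_domain_def by blast
  then obtain c where c: "\<And>i. Polynomial.coeff P i = to_fract (c i)" by metis
  \<comment> \<open>To recover the coefficients with \<open>map_poly\<close>, the inverse of
    \<open>to_fract\<close> has to fix \<open>0\<close>.\<close>
  have inj: "inj (to_fract :: 'd \<Rightarrow> _)" by (simp add: inj_def)
  then have "inv_into UNIV to_fract (0 :: 'd fract) = (0 :: 'd)"
    by (rule inv_f_eq) simp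
  then have "P = fract_poly (map_poly (inv_into UNIV to_fract) P)"
    by (intro poly_eqI) (simp add: coeff_map_poly c inv_f_f[OF inj])
  then show ?thesis ..
qed

text \<open>The minimal polynomial of \<open>b\<close> over \<open>K\<close> has degree at most
  \<open>card G\<close> and divides any monic polynomial over \<open>D\<close> vanishing at
  \<open>b\<close>; as a monic factor it has coefficients in \<open>D\<close>.\<close>

lemma (in fract_algebra) integral_degree_le:
  assumes ic: "integrally_closed_domain TYPE('d)" and frr: "finite_residue_rings TYPE('d)"
    and "finite G" "K.span G = UNIV" "integral_elt \<phi> b"
  shows "\<exists>m\<le>card G. b ^ m \<in> D.span ((^) b ` {..<m})"
proof -
  let ?pow = "\<lambda>m. b ^ m \<in> K.span ((^) b ` {..<m})"
  obtain m0 where m0: "m0 \<le> card G" "?pow m0"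
    using power_in_span_K[OF assms(3), of b] assms(4) by auto
  \<comment> \<open>Leastness makes the monic \<open>P\<close> below the minimal polynomial of
    \<open>b\<close>.\<close>
  define m where "m = (LEAST m. ?pow m)"
  have m: "?pow m" "m \<le> card G"
    unfolding m_def using m0 by (auto intro: LeastI Least_le[THEN order_trans])
  obtain P where P: "Polynomial.lead_coeff P = 1" "Polynomial.degree P = m" "alg_eval \<kappa> P b = 0"
    using K.span_powers_imp_monic[OF m(1)] by blast
  obtain q where q: "Polynomial.lead_coeff q = 1" "alg_eval \<phi> q b = 0"
    using assms(5) unfolding integral_elt_def by blast
  let ?R = "fract_poly q mod P"
  have "alg_eval \<kappa> (fract_poly q div P * P + ?R) b = 0"
    unfolding div_mult_mod_eq by (simp add: alg_eval_fract_poly q)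
  then have R0: "alg_eval \<kappa> ?R b = 0"
    by (simp only: K.alg_eval_add K.alg_eval_mult P(3)) simp
  have "?R = 0"
  proof (rule ccontr)
    assume "?R \<noteq> 0"
    \<comment> \<open>A nonzero remainder, made monic, would be a relation of degree less than
      \<open>m\<close>.\<close>
    define R where "R = Polynomial.smult (inverse (Polynomial.lead_coeff ?R)) ?R"
    have "Polynomial.lead_coeff R = 1" "alg_eval \<kappa> R b = 0" "Polynomial.degree R = Polynomial.degree ?R"
      using \<open>?R \<noteq> 0\<close> by (simp_all add: R_def R0 K.alg_eval_smult)
    then have "?pow (Polynomial.degree ?R)"
      using K.monic_eval_0_imp_span_powers[of R b] by simp
    then have "m \<le> Polynomial.degree ?R"
      unfolding m_def by (rule Least_le)
    moreover have "P \<noteq> 0" using P(1) by auto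
    then have "Polynomial.degree ?R < m"
      using degree_mod_less[of P "fract_poly q"] \<open>?R \<noteq> 0\<close> P(2) by simp
    ultimately show False by simp
  qed
  then have "P dvd fract_poly q" by (simp add: dvd_eq_mod_eq_0)
  then obtain p where p: "P = fract_poly p"
    using monic_factor_in_fract_poly[OF ic frr q(1) P(1)] by blast
  have deg: "Polynomial.degree p = m"
    using P(2) unfolding p by (simp add: degree_map_poly)
  have "to_fract (Polynomial.lead_coeff p) = 1"
    using P(1) unfolding p by (simp add: degree_map_poly coeff_map_poly)
  then have "Polynomial.lead_coeff p = 1"
    by (metis to_fract_1 to_fract_eq_iff)
  moreover have "alg_eval \<phi> p b = 0"
    using P(3) by (simp add: p alg_eval_fract_poly)
  ultimately show ?thesis
    using D.monic_eval_0_imp_span_powers[of p b] deg m(2) by auto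
qed

section \<open>Mapping integral elements into an order, and the density criterion\<close>

context fract_algebra
begin

text \<open>One \<open>h\<close> must serve all \<open>b\<close>. The pair of congruent powers
  varies with \<open>b\<close>, so \<open>h\<close> contains the factors for all possible
  pairs.\<close>

lemma monic_maps_integral_into_order:
  assumes ic: "integrally_closed_domain TYPE('d)" and frr: "finite_residue_rings TYPE('d)"
    and G: "finite G" "K.span G = UNIV" and one: "1 \<in> D.span G"
    and mult: "\<And>x y. x \<in> D.span G \<Longrightarrow> y \<in> D.span G \<Longrightarrow> x * y \<in> D.span G"
    and "d \<noteq> 0"
  shows "\<exists>h. Polynomial.lead_coeff h = 1 \<and> Polynomial.degree h > 0 \<and>
    (\<forall>b. integral_elt \<phi> b \<longrightarrow> \<phi> d * b \<in> D.span G \<longrightarrow> alg_eval \<phi> h b \<in> D.span G)"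
proof -
  \<comment> \<open>This clears the denominators of all powers of \<open>b\<close> below the degree
    bound \<open>card G\<close>.\<close>
  define e where "e = d ^ card G"
  have "e \<noteq> 0" using assms(7) by (simp add: e_def)
  \<comment> \<open>The multiples \<open>e * b ^ i\<close> are compared; modulus
    \<open>e * e\<close> leaves one factor \<open>e\<close> after cancelling.\<close>
  obtain R where "finite R" "\<And>c. \<exists>r\<in>R. e * e dvd c - r"
    using finite_representatives[OF frr, of "e * e"] \<open>e \<noteq> 0\<close> by auto
  from D.span_pigeonhole[OF this G(1)]
  obtain N where N: "\<forall>x :: nat \<Rightarrow> 'b. (\<forall>i. x i \<in> D.span G) \<longrightarrow>
      (\<exists>i\<le>N. \<exists>j<i. \<exists>z\<in>D.span G. x i - x j = \<phi> (e * e) * z)"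
    by blast
  define u :: "nat \<times> nat \<Rightarrow> 'd poly"
    where "u = (\<lambda>(i, j). Polynomial.monom 1 i - Polynomial.monom 1 j)"
  define I where "I = {(i, j). i \<le> N \<and> j < i}"
  \<comment> \<open>The factor \<open>X\<close> gives positive degree, whatever the index set
    \<open>I\<close> is.\<close>
  define h where "h = Polynomial.monom 1 1 * prod u I"
  have "I \<subseteq> {..N} \<times> {..N}" by (auto simp: I_def)
  then have "finite I" by (rule finite_subset) simp
  have "Polynomial.lead_coeff (u a) = 1" if aI: "a \<in> I" for a
  proof -
    obtain i j where a: "a = (i, j)" "j < i" using aI by (auto simp: I_def)
    have "Polynomial.degree (u a) = i"
      using a by (intro antisym degree_le le_degree) (auto simp: u_def)
    then show ?thesis using a by (simp add: u_def)
  qed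
  then have monic: "Polynomial.lead_coeff (prod u I) = 1"
    unfolding lead_coeff_prod by simp
  have lead: "Polynomial.lead_coeff h = 1"
    unfolding h_def lead_coeff_mult monic by (simp add: degree_monom_eq)
  have "prod u I \<noteq> 0" using monic by auto
  then have deg: "Polynomial.degree h > 0"
    unfolding h_def by (subst degree_mult_eq) (simp_all add: degree_monom_eq)
  have "alg_eval \<phi> h b \<in> D.span G" if b: "integral_elt \<phi> b" "\<phi> d * b \<in> D.span G" for b
  proof -
    obtain m where m: "m \<le> card G" "b ^ m \<in> D.span ((^) b ` {..<m})"
      using integral_degree_le[OF ic frr G b(1)] by blast
    have low: "\<phi> e * b ^ k \<in> D.span G" if "k < m" for k
    proof -
      have db: "\<phi> (d ^ k) * b ^ k \<in> D.span G" for k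
      proof (induction k)
        case 0
        show ?case using one by simp
      next
        case (Suc k)
        have "\<phi> (d ^ Suc k) * b ^ Suc k = (\<phi> d * b) * (\<phi> (d ^ k) * b ^ k)"
          using D.left_commute[of b "d ^ k" "b ^ k"] by (simp add: mult.assoc D.hom_mult del: D.scale_scale)
        then show ?case using mult[OF b(2) Suc] by (simp only:)
      qed
      \<comment> \<open>The subtraction is not truncated, since
        \<open>k < m \<le> card G\<close>.\<close>
      have "e = d ^ (card G - k) * d ^ k"
        using that m(1) by (simp add: e_def flip: power_add)
      then have "\<phi> e * b ^ k = \<phi> (d ^ (card G - k)) * (\<phi> (d ^ k) * b ^ k)"
        by simp
      then show ?thesis using D.span_scale[OF db] by (simp only:)
    qed
    have "D.span ((^) b ` {..<m}) \<subseteq> {x. \<phi> e * x \<in> D.span G}"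
      using low by (intro D.span_minimal D.subspace_mult_left) auto
    then have pow: "\<phi> e * b ^ i \<in> D.span G" for i
      using D.powers_in_span_powers[OF m(2), of i] by blast
    obtain i j z where ij: "i \<le> N" "j < i" "z \<in> D.span G"
      "\<phi> e * b ^ i - \<phi> e * b ^ j = \<phi> (e * e) * z"
      using N[THEN spec, of "\<lambda>i. \<phi> e * b ^ i"] pow by blast
    have "b ^ i - b ^ j = \<phi> e * z"
      by (rule cancel[OF \<open>e \<noteq> 0\<close>]) (use ij(4) in \<open>simp add: right_diff_distrib\<close>)
    then have u: "alg_eval \<phi> (u (i, j)) b = \<phi> e * z"
      by (simp add: u_def D.alg_eval_diff D.alg_eval_monom)
    have "u (i, j) dvd prod u I"
      using \<open>finite I\<close> ij by (intro dvd_prodI) (simp_all add: I_def)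
    then obtain k where k: "h = k * u (i, j)"
      unfolding h_def by (metis dvdE dvd_mult mult.commute)
    \<comment> \<open>The factor \<open>e\<close> left in the congruence clears the denominator of
      the cofactor: \<open>k(b) * (e z) = (e k(b)) * z\<close>.\<close>
    have "alg_eval \<phi> k b \<in> {x. \<phi> e * x \<in> D.span G}"
      using pow by (intro D.alg_eval_in_subspace D.subspace_mult_left) auto
    then have "(\<phi> e * alg_eval \<phi> k b) * z \<in> D.span G"
      using ij(3) by (blast intro: mult)
    then show ?thesis
      by (simp add: k D.alg_eval_mult u D.left_commute[of "alg_eval \<phi> k b"] mult.assoc)
  qed
  with lead deg show ?thesis by blast
qed

text \<open>Composing an integral equation of \<open>h(b)\<close> with \<open>h\<close> gives one
  for \<open>b\<close>; positive degree of \<open>h\<close> keeps the composite monic.\<close>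

lemma integral_of_monic_eval:
  assumes h: "Polynomial.lead_coeff h = 1" "Polynomial.degree h > 0"
    and "integral_elt \<phi> (alg_eval \<phi> h b)"
  shows "integral_elt \<phi> b"
proof -
  obtain p where p: "Polynomial.lead_coeff p = 1" "alg_eval \<phi> p (alg_eval \<phi> h b) = 0"
    using assms(3) unfolding integral_elt_def by blast
  have "Polynomial.lead_coeff (pcompose p h) = 1"
    unfolding lead_coeff_comp[OF h(2)] h(1) p(1) by simp
  then show ?thesis
    using p(2) unfolding integral_elt_def D.alg_eval_pcompose[symmetric] by blast
qed

text \<open>Left multiplication by \<open>s\<close> maps the order into itself. This will be the
  inclusion of \<open>A\<close> in \<open>A'\<close>.\<close>

lemma order_integral:
  assumes "finite_residue_rings TYPE('d)" "finite G" "1 \<in> D.span G"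
    and "\<And>x y. x \<in> D.span G \<Longrightarrow> y \<in> D.span G \<Longrightarrow> x * y \<in> D.span G" and "s \<in> D.span G"
  shows "integral_elt \<phi> s"
  using assms by (intro integral_if_stable_span[of G]) (auto intro: D.span_base)

text \<open>\<open>D.span G\<close> plays the part of \<open>A\<close> inside \<open>B\<close>. Its
  integrality settles the forward direction and one half of density; the other half composes
  \<open>f\<close> with the monic polynomial above.\<close>

theorem order_polynomially_dense_iff:
  assumes ic: "integrally_closed_domain TYPE('d)" and frr: "finite_residue_rings TYPE('d)"
    and G: "finite G" "K.span G = UNIV" and one: "1 \<in> D.span G"
    and mult: "\<And>x y. x \<in> D.span G \<Longrightarrow> y \<in> D.span G \<Longrightarrow> x * y \<in> D.span G"
  shows "polynomially_dense \<kappa> (D.span G) {b. integral_elt \<phi> b} \<longleftrightarrow>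
    Int_poly \<kappa> (D.span G) (D.span G) \<subseteq> Int_poly \<kappa> {b. integral_elt \<phi> b} {b. integral_elt \<phi> b}"
proof
  have sub: "D.span G \<subseteq> {b. integral_elt \<phi> b}"
    using order_integral[OF frr G(1) one mult] by blast
  then have sub1: "Int_poly \<kappa> (D.span G) (D.span G) \<subseteq> Int_poly \<kappa> (D.span G) {b. integral_elt \<phi> b}"
    and sub2: "Int_poly \<kappa> {b. integral_elt \<phi> b} {b. integral_elt \<phi> b}
      \<subseteq> Int_poly \<kappa> (D.span G) {b. integral_elt \<phi> b}"
    unfolding Int_poly_def by blast+
  show "Int_poly \<kappa> (D.span G) (D.span G) \<subseteq> Int_poly \<kappa> {b. integral_elt \<phi> b} {b. integral_elt \<phi> b}"
    if "polynomially_dense \<kappa> (D.span G) {b. integral_elt \<phi> b}"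
    using that sub1 unfolding polynomially_dense_def by simp
  show "polynomially_dense \<kappa> (D.span G) {b. integral_elt \<phi> b}"
    if Int: "Int_poly \<kappa> (D.span G) (D.span G) \<subseteq> Int_poly \<kappa> {b. integral_elt \<phi> b} {b. integral_elt \<phi> b}"
    unfolding polynomially_dense_def
  proof (rule antisym[OF _ sub2], rule subsetI)
    fix f assume "f \<in> Int_poly \<kappa> (D.span G) {b. integral_elt \<phi> b}"
    then have f: "integral_elt \<phi> (alg_eval \<kappa> f a)" if "a \<in> D.span G" for a
      using that unfolding Int_poly_def by blast
    obtain d g where dg: "d \<noteq> 0" "Polynomial.smult (to_fract d) f = fract_poly g"
      using fract_poly_clear_denominators by blast
    obtain h where h: "Polynomial.lead_coeff h = 1" "Polynomial.degree h > 0"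
      "\<And>b. integral_elt \<phi> b \<Longrightarrow> \<phi> d * b \<in> D.span G \<Longrightarrow> alg_eval \<phi> h b \<in> D.span G"
      using monic_maps_integral_into_order[OF ic frr G one mult dg(1)] by blast
    define F where "F = pcompose (fract_poly h) f"
    have F: "alg_eval \<kappa> F b = alg_eval \<phi> h (alg_eval \<kappa> f b)" for b
      by (simp add: F_def K.alg_eval_pcompose alg_eval_fract_poly)
    have "alg_eval \<kappa> F a \<in> D.span G" if a: "a \<in> D.span G" for a
    proof -
      \<comment> \<open>As \<open>A\<close> is a ring, it contains \<open>g(a) = d f(a)\<close>, the
        second condition for applying \<open>h\<close>.\<close>
      have "a ^ i \<in> D.span G" for i
        by (induction i) (simp_all add: one mult a)
      then have "alg_eval \<phi> g a \<in> D.span G"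
        by (intro D.alg_eval_in_subspace) auto
      also have "alg_eval \<phi> g a = \<phi> d * alg_eval \<kappa> f a"
        unfolding alg_eval_fract_poly[symmetric] dg(2)[symmetric] K.alg_eval_smult \<phi>_eq ..
      finally show ?thesis unfolding F using h(3) f[OF a] by blast
    qed
    then have "F \<in> Int_poly \<kappa> (D.span G) (D.span G)"
      unfolding Int_poly_def by blast
    then have F': "F \<in> Int_poly \<kappa> {b. integral_elt \<phi> b} {b. integral_elt \<phi> b}"
      using Int by blast
    have "integral_elt \<phi> (alg_eval \<kappa> f b)" if "integral_elt \<phi> b" for b
    proof (rule integral_of_monic_eval[OF h(1,2)])
      show "integral_elt \<phi> (alg_eval \<phi> h (alg_eval \<kappa> f b))"
        using F' that unfolding Int_poly_def F[symmetric] by blast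
    qed
    then show "f \<in> Int_poly \<kappa> {b. integral_elt \<phi> b} {b. integral_elt \<phi> b}"
      unfolding Int_poly_def by blast
  qed
qed

end

section \<open>Consequences of the tensor product description of \<open>B\<close>\<close>

lemma tensor_value_superset:
  assumes "finite S" "Poly_Mapping.keys x \<subseteq> S"
  shows "tensor_value \<alpha> \<kappa> x =
    (\<Sum>(a, k)\<in>S. of_int (Poly_Mapping.lookup x (a, k)) * (\<alpha> a * \<kappa> k))"
  unfolding tensor_value_def using assms
  by (intro sum.mono_neutral_left) (auto simp: in_keys_iff)

lemma tensor_value_frag_diff:
  "tensor_value \<alpha> \<kappa> (frag_of (a, k) - frag_of (a', k')) = \<alpha> a * \<kappa> k - \<alpha> a' * \<kappa> k'"
\<comment> \<open>Equal pairs cancel to \<open>0\<close>; the two-element sum below presupposes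
  distinct ones.\<close>
proof (cases "(a, k) = (a', k')")
  case True
  then show ?thesis by (simp add: tensor_value_def)
next
  case False
  have "Poly_Mapping.keys (frag_of (a, k) - frag_of (a', k')) \<subseteq> {(a, k), (a', k')}"
    by (auto simp: in_keys_iff lookup_minus lookup_single when_def split: if_splits)
  then have "tensor_value \<alpha> \<kappa> (frag_of (a, k) - frag_of (a', k')) =
      (\<Sum>(b, l)\<in>{(a, k), (a', k')}.
        of_int (Poly_Mapping.lookup (frag_of (a, k) - frag_of (a', k')) (b, l)) * (\<alpha> b * \<kappa> l))"
    by (intro tensor_value_superset) simp_all
  also have "\<dots> = \<alpha> a * \<kappa> k - \<alpha> a' * \<kappa> k'"
    using False by (auto simp: lookup_minus lookup_single when_def)
  finally show ?thesis .
qed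

text \<open>This is the balancing relation for the pair of units, evaluated in
  \<open>B\<close>.\<close>

lemma is_tensor_product_structure_maps:
  assumes "is_tensor_product \<iota> j \<alpha> \<kappa>"
  shows "\<alpha> (\<iota> d) = \<kappa> (j d)"
proof -
  have hom: "\<alpha> 1 = 1" "\<kappa> 1 = 1"
    using assms by (simp_all add: is_tensor_product_def is_ring_hom_def)
  have "frag_of (\<iota> d * 1, 1) - frag_of (1, j d * 1) \<in> tensor_relations \<iota> j"
    by (rule tensor_relations.balanced)
  then have "tensor_value \<alpha> \<kappa> (frag_of (\<iota> d * 1, 1) - frag_of (1, j d * 1)) = 0"
    using assms unfolding is_tensor_product_def by blast
  then show ?thesis by (simp add: tensor_value_frag_diff hom)
qed

text \<open>Elements of \<open>K\<close> commute with each other and with the image of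
  \<open>A\<close>, and products of the two kinds generate \<open>B\<close> additively.\<close>

lemma is_tensor_product_is_algebra_map:
  assumes "is_tensor_product \<iota> j \<alpha> \<kappa>"
  shows "is_algebra_map \<kappa>"
proof -
  have comm: "\<kappa> c * (\<alpha> a * \<kappa> k) = \<alpha> a * \<kappa> k * \<kappa> c" for a k c
  proof -
    have "\<kappa> c * \<kappa> k = \<kappa> k * \<kappa> c"
      using assms unfolding is_tensor_product_def is_ring_hom_def by (metis mult.commute)
    moreover have "\<alpha> a * \<kappa> c = \<kappa> c * \<alpha> a"
      using assms unfolding is_tensor_product_def by blast
    ultimately show ?thesis by (metis mult.assoc)
  qed
  have "\<kappa> c * b = b * \<kappa> c" for c b
  proof -
    obtain x where "b = tensor_value \<alpha> \<kappa> x"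
      using assms unfolding is_tensor_product_def by (metis surjD)
    moreover have "\<kappa> c * (of_int n * (\<alpha> a * \<kappa> k)) = of_int n * (\<alpha> a * \<kappa> k) * \<kappa> c" for n a k
      by (metis comm mult.assoc mult_of_int_commute)
    ultimately show ?thesis
      by (simp add: tensor_value_def sum_distrib_left sum_distrib_right case_prod_unfold)
  qed
  then show ?thesis
    using assms unfolding is_algebra_map_def is_tensor_product_def by blast
qed

text \<open>Lets the integer coefficients of formal sums be absorbed into scalars from
  \<open>K\<close>.\<close>

lemma (in algebra_map) hom_of_int: "\<phi> (of_int n) = of_int n"
proof -
  have nat: "\<phi> (of_nat n) = of_nat n" for n
    by (induction n) (simp_all add: hom_add)
  have "\<phi> (- x) = - \<phi> x" for x
    using hom_add[of x "- x"] by (simp add: eq_neg_iff_add_eq_0 add.commute)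
  with nat show ?thesis
    by (cases n rule: int_diff_cases) (simp add: hom_add diff_conv_add_uminus del: add_uminus_conv_diff)
qed

text \<open>Each term \<open>n * (a \<otimes> k)\<close> is the scalar \<open>n k\<close> times the
  image of \<open>a\<close>.\<close>

lemma is_tensor_product_span:
  assumes "is_tensor_product \<iota> j \<alpha> \<kappa>"
  shows "module.span (\<lambda>k x. \<kappa> k * x) (range \<alpha>) = UNIV"
proof -
  interpret K: algebra_map \<kappa>
    by unfold_locales (rule is_tensor_product_is_algebra_map[OF assms])
  have "b \<in> K.span (range \<alpha>)" for b
  proof -
    obtain x where x: "b = tensor_value \<alpha> \<kappa> x"
      using assms unfolding is_tensor_product_def by (metis surjD)
    have "of_int n * (\<alpha> a * \<kappa> k) = \<kappa> (of_int n * k) * \<alpha> a" for n a k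
      by (simp add: K.hom_mult K.hom_of_int K.central mult.assoc del: K.scale_scale)
    then show ?thesis
      unfolding x tensor_value_def case_prod_unfold
      by (intro K.span_sum) (simp add: K.span_scale K.span_base)
  qed
  then show ?thesis by blast
qed

theorem proposition4p5:
  fixes \<iota> :: "'d::idom \<Rightarrow> 'a::ring_1"
    and \<alpha> :: "'a \<Rightarrow> 'b::ring_1"
    and \<kappa> :: "'d fract \<Rightarrow> 'b"
  assumes "integrally_closed_domain TYPE('d)"
    and "is_algebra_map \<iota>" and "inj \<iota>"
    and "torsion_free_algebra \<iota>"
    and "module_finite_algebra \<iota>"
    and "is_tensor_product \<iota> to_fract \<alpha> \<kappa>"
    and "finite_residue_rings TYPE('d)"
  shows "polynomially_dense \<kappa> (range \<alpha>) (integral_elements \<kappa>) \<longleftrightarrow>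
         Int_poly \<kappa> (range \<alpha>) (range \<alpha>)
           \<subseteq> Int_poly \<kappa> (integral_elements \<kappa>) (integral_elements \<kappa>)"
proof -
  define \<phi> where "\<phi> = \<kappa> \<circ> to_fract"
  have alg: "is_algebra_map \<kappa>"
    by (rule is_tensor_product_is_algebra_map[OF assms(6)])
  interpret fract_algebra \<kappa> \<phi>
    by unfold_locales (use alg in \<open>simp_all add: \<phi>_def is_algebra_map_comp_to_fract\<close>)
  interpret I: algebra_map \<iota>
    by unfold_locales (rule assms(2))
  have add: "\<alpha> (x + y) = \<alpha> x + \<alpha> y" and mult: "\<alpha> (x * y) = \<alpha> x * \<alpha> y" and one: "\<alpha> 1 = 1" for x y
    using assms(6) by (simp_all add: is_tensor_product_def is_ring_hom_def)
  have zero: "\<alpha> 0 = 0" using add[of 0 0] by simp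
  have scale: "\<alpha> (\<iota> d * a) = \<phi> d * \<alpha> a" for d a
    using is_tensor_product_structure_maps[OF assms(6)] by (simp add: mult \<phi>_def)
  obtain G where G: "finite G" "I.span G = UNIV"
    using assms(5) unfolding module_finite_algebra_def by blast
  \<comment> \<open>\<open>\<alpha>\<close> is \<open>D\<close>-linear, so the images of the
    generators of \<open>A\<close> span \<open>range \<alpha>\<close> over \<open>D\<close>.\<close>
  have "I.span G \<subseteq> {a. \<alpha> a \<in> D.span (\<alpha> ` G)}"
  proof (rule I.span_minimal)
    show "G \<subseteq> {a. \<alpha> a \<in> D.span (\<alpha> ` G)}" by (auto intro: D.span_base)
    show "I.subspace {a. \<alpha> a \<in> D.span (\<alpha> ` G)}"
      by (rule I.subspaceI) (simp_all add: zero add scale D.span_zero D.span_add D.span_scale)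
  qed
  moreover have "D.span (\<alpha> ` G) \<subseteq> range \<alpha>"
  proof (rule D.span_minimal)
    show "D.subspace (range \<alpha>)"
      by (rule D.subspaceI) (auto simp flip: zero add scale)
  qed blast
  ultimately have span: "D.span (\<alpha> ` G) = range \<alpha>"
    using G(2) by blast
  have "range \<alpha> \<subseteq> K.span (\<alpha> ` G)"
    using span_D_subset_span_K[of "\<alpha> ` G"] by (simp only: span)
  then have "K.span (\<alpha> ` G) = UNIV"
    using K.span_minimal[OF _ K.subspace_span] is_tensor_product_span[OF assms(6)] by blast
  moreover have "1 \<in> range \<alpha>" by (metis one rangeI)
  moreover have "x * y \<in> range \<alpha>" if "x \<in> range \<alpha>" "y \<in> range \<alpha>" for x y
    using that by (auto simp flip: mult)
  moreover have "integral_elements \<kappa> = {b. integral_elt \<phi> b}"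
    by (simp add: integral_elements_def \<phi>_def)
  ultimately show ?thesis
    using order_polynomially_dense_iff[OF assms(1,7), of "\<alpha> ` G", unfolded span] G(1)
    by (simp only: finite_imageI)
qed

end
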